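(* Let $k\ge1$, $\ell\ge0$, $m\ge 1$ be integers. Let $A_1=(a_1,1),\ldots,A_k=(a_k,1)$ for some integers $1\le a_1<a_2<\cdots<a_k\le k+\ell$, and $\mathcal A=(A_1,\ldots,A_k)$. Let $B_1=(b_1,m),\ldots,B_k=(b_k,m)$ for some integers $1\le b_1<b_2<\cdots<b_k\le k+\ell$, and $\mathcal B=(B_1,\ldots,B_k)$. Then the multivariate rational function $$F_{\mathcal A,\mathcal B}(x_1,\ldots,x_{k+\ell}\mid y_1,\ldots,y_m)=\sum_{\Upsilon:\,\mathcal A\to\mathcal B} w(\Upsilon)$$ is symmetric in $(y_1,\ldots,y_m)$.
   Context: Let $[(k+\ell)\times m]=\{(p,q)\in\mathbb N^2: 1\le p\le k+\ell,\ 1\le q\le m\}$, with matrix coordinates: the first coordinate (row index) increases downwards and the second coordinate (column index) increases from left to right. A lattice path $\gamma:A\to B$ is a sequence of points of $[(k+\ell)\times m]$ starting at $A$ and ending at $B$ using only Up steps $(p,q)\to(p-1,q)$ and Right steps $(p,q)\to(p,q+1)$ (a path with no steps is allowed when $A=B$); it is identified with the set of points it visits, including both endpoints. For $k$-tuples of points $\mathcal A=(A_1,\ldots,A_k)$ and $\mathcal B=(B_1,\ldots,B_k)$ in this rectangle, $\Upsilon:\mathcal A\to\mathcal B$ denotes a collection $\Upsilon=(\gamma_1,\ldots,\gamma_k)$ of non-intersecting (pairwise having no common point) lattice paths $\gamma_i:A_i\to B_i$. The weights are $$w(\gamma)=\prod_{(i,j)\in\gamma}\frac1{x_i+y_j},\qquad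 w(\Upsilon)=\prod_{i=1}^k w(\gamma_i),$$ where $x_1,\ldots,x_{k+\ell},y_1,\ldots,y_m$ are independent variables. The sum defining $F_{\mathcal A,\mathcal B}$ is over all such collections $\Upsilon$ (an empty sum is $0$). Symmetric in $(y_1,\ldots,y_m)$ means invariant, as a rational function, under all permutations of $y_1,\ldots,y_m$ with the $x_i$ fixed. *)

theory Defs
  imports
    "HOL-Library.Poly_Mapping"
    "HOL-Computational_Algebra.Fraction_Field"
    "HOL-Combinatorics.Permutations"
begin

section \<open>Rational functions in the variables \<open>x\<^sub>i\<close>, \<open>y\<^sub>j\<close>\<close>

datatype var = XV nat | YV nat

text \<open>
  The linear order on variables has no mathematical role: it is what makes the library's
  polynomial type an instance of \<^class>\<open>idom\<close>, so that its fraction field is available.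
\<close>

fun var_key :: "var \<Rightarrow> nat" where
  "var_key (XV i) = 2 * i"
| "var_key (YV j) = 2 * j + 1"

lemma var_key_inject: "var_key u = var_key v \<Longrightarrow> u = v"
  by (cases u; cases v) (simp_all, presburger+)

instantiation var :: linorder
begin

definition less_eq_var :: "var \<Rightarrow> var \<Rightarrow> bool"
  where "u \<le> v \<longleftrightarrow> var_key u \<le> var_key v"

definition less_var :: "var \<Rightarrow> var \<Rightarrow> bool"
  where "u < v \<longleftrightarrow> var_key u < var_key v"

instance
  by standard (auto simp: less_eq_var_def less_var_def intro: var_key_inject)

end

text \<open>
  Monomials are finitely supported exponent functions \<open>var \<Rightarrow>\<^sub>0 nat\<close>; polynomials are
  finitely supported families of coefficients indexed by monomials. There are infinitely
  many variables, of which only \<open>x\<^sub>1, \<dots>, x\<^bsub>n\<^esub>, y\<^sub>1, \<dots>, y\<^bsub>m\<^esub>\<close> are used.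
\<close>

type_synonym 'a mpoly_xy = "(var \<Rightarrow>\<^sub>0 nat) \<Rightarrow>\<^sub>0 'a"
type_synonym 'a ratfun = "'a mpoly_xy fract"

definition var_poly :: "var \<Rightarrow> 'a::field mpoly_xy" where
  "var_poly v = Poly_Mapping.single (Poly_Mapping.single v 1) 1"

definition x_var :: "nat \<Rightarrow> 'a::field ratfun" where
  "x_var i = Fract (var_poly (XV i)) 1"

definition y_var :: "nat \<Rightarrow> 'a::field ratfun" where
  "y_var j = Fract (var_poly (YV j)) 1"


section \<open>Permuting variables in a rational function\<close>

text \<open>
  For bijective \<open>\<sigma>\<close>, \<open>rename_poly \<sigma> p\<close> is \<open>p\<close> with every variable \<open>v\<close> replaced by \<open>\<sigma> v\<close>:
  the coefficient of a monomial \<open>e\<close> in the result is the coefficient of \<open>e \<circ> \<sigma>\<close> in \<open>p\<close>.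
\<close>

definition rename_poly :: "(var \<Rightarrow> var) \<Rightarrow> 'a::field mpoly_xy \<Rightarrow> 'a mpoly_xy" where
  "rename_poly \<sigma> = Poly_Mapping.map_key (Poly_Mapping.map_key \<sigma>)"

lemma inj_map_key:
  assumes "bij \<sigma>"
  shows "inj (Poly_Mapping.map_key \<sigma> :: (var \<Rightarrow>\<^sub>0 nat) \<Rightarrow> _)"
proof (rule injI)
  fix e f :: "var \<Rightarrow>\<^sub>0 nat"
  assume "Poly_Mapping.map_key \<sigma> e = Poly_Mapping.map_key \<sigma> f"
  then have "Poly_Mapping.lookup e (\<sigma> v) = Poly_Mapping.lookup f (\<sigma> v)" for v
    using assms by (metis bij_is_inj comp_apply map_key.rep_eq)
  then show "e = f"
    using assms by (metis bij_pointE poly_mapping_eqI)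
qed

lemma map_key_inv:
  assumes "bij \<sigma>"
  shows "Poly_Mapping.map_key \<sigma> (Poly_Mapping.map_key (inv \<sigma>) e) = e"
  using assms by (simp add: map_key_compose bij_is_inj bij_imp_bij_inv map_key_id[unfolded id_def[symmetric]])

lemma rename_poly_single:
  assumes "bij \<sigma>"
  shows "rename_poly \<sigma> (Poly_Mapping.single e c) =
           Poly_Mapping.single (Poly_Mapping.map_key (inv \<sigma>) e) c"
  unfolding rename_poly_def
  by (metis assms inj_map_key map_key_inv map_key_single)

lemma rename_poly_add:
  assumes "bij \<sigma>"
  shows "rename_poly \<sigma> (p + q) = rename_poly \<sigma> p + rename_poly \<sigma> q"
  unfolding rename_poly_def by (rule map_key_plus[OF inj_map_key[OF assms]])

lemma rename_poly_0: "bij \<sigma> \<Longrightarrow> rename_poly \<sigma> 0 = 0"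
  unfolding rename_poly_def by (rule map_key_zero[OF inj_map_key])

lemma poly_mapping_single_induct:
  fixes p :: "'k \<Rightarrow>\<^sub>0 'c::comm_monoid_add"
  assumes "P 0" and "\<And>p k c. P p \<Longrightarrow> P (Poly_Mapping.single k c + p)"
  shows "P p"
proof (induction p rule: update_induct)
  case const
  show ?case by fact
next
  case (update f a b)
  have "Poly_Mapping.update a b f = Poly_Mapping.single a b + f"
    using update.hyps
    by (intro poly_mapping_eqI)
       (auto simp: lookup_update lookup_add lookup_single when_def in_keys_iff)
  then show ?case
    using assms(2)[OF update.IH] by simp
qed

lemma rename_poly_mult:
  assumes "bij \<sigma>"
  shows "rename_poly \<sigma> (p * q) = rename_poly \<sigma> p * rename_poly \<sigma> q"
proof -
  have inj: "inj (inv \<sigma>)"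
    using assms by (simp add: bij_imp_bij_inv bij_is_inj)
  have *: "rename_poly \<sigma> (Poly_Mapping.single e c * q) =
          rename_poly \<sigma> (Poly_Mapping.single e c) * rename_poly \<sigma> q" for e c q
    by (induction q rule: poly_mapping_single_induct)
       (simp_all add: rename_poly_0 rename_poly_add rename_poly_single assms distrib_left
          mult_single map_key_plus[OF inj])
  show ?thesis
    by (induction p rule: poly_mapping_single_induct)
       (simp_all add: rename_poly_0 rename_poly_add assms distrib_right *)
qed

lemma rename_poly_eq_0_iff:
  assumes "bij \<sigma>"
  shows "rename_poly \<sigma> p = 0 \<longleftrightarrow> p = 0"
proof
  assume 0: "rename_poly \<sigma> p = 0"
  show "p = 0"
  proof (rule poly_mapping_eqI)
    fix e
    have "Poly_Mapping.lookup (rename_poly \<sigma> p) (Poly_Mapping.map_key (inv \<sigma>) e) = Poly_Mapping.lookup p e"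
      unfolding rename_poly_def
      by (simp add: map_key.rep_eq[OF inj_map_key[OF assms]] map_key_inv[OF assms])
    then show "Poly_Mapping.lookup p e = Poly_Mapping.lookup 0 e"
      using 0 by simp
  qed
qed (use assms rename_poly_0 in simp)

text \<open>Only bijective \<open>\<sigma>\<close> matter below; the other branch makes the definition total.\<close>

lift_definition rename :: "(var \<Rightarrow> var) \<Rightarrow> 'a::field ratfun \<Rightarrow> 'a ratfun" is
  "\<lambda>\<sigma> (p, q). if bij \<sigma> then (rename_poly \<sigma> p, rename_poly \<sigma> q) else (p, q)"
  by (auto simp: rename_poly_eq_0_iff rename_poly_mult[symmetric] split: if_splits)

lemma rename_Fract:
  "bij \<sigma> \<Longrightarrow> rename \<sigma> (Fract p q) = Fract (rename_poly \<sigma> p) (rename_poly \<sigma> q)"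
  by transfer (auto simp: rename_poly_eq_0_iff rename_poly_0 rename_poly_mult[symmetric])

fun perm_y :: "(nat \<Rightarrow> nat) \<Rightarrow> var \<Rightarrow> var" where
  "perm_y \<pi> (XV i) = XV i"
| "perm_y \<pi> (YV j) = YV (\<pi> j)"

lemma bij_perm_y:
  assumes "bij \<pi>"
  shows "bij (perm_y \<pi>)"
proof (rule o_bij)
  show "perm_y (inv \<pi>) \<circ> perm_y \<pi> = id"
  proof
    show "(perm_y (inv \<pi>) \<circ> perm_y \<pi>) v = id v" for v
      using assms by (cases v) (auto simp: bij_is_inj)
  qed
  show "perm_y \<pi> \<circ> perm_y (inv \<pi>) = id"
  proof
    show "(perm_y \<pi> \<circ> perm_y (inv \<pi>)) v = id v" for v
      using assms by (cases v) (auto simp: bij_is_surj surj_f_inv_f)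
  qed
qed

lemma map_key_inv_single:
  assumes "bij \<sigma>"
  shows "Poly_Mapping.map_key (inv \<sigma>) (Poly_Mapping.single v c) = Poly_Mapping.single (\<sigma> v) c"
  using assms
  by (metis bij_imp_bij_inv bij_is_inj inv_f_f map_key_single)

lemma rename_poly_1: "bij \<sigma> \<Longrightarrow> rename_poly \<sigma> 1 = 1"
  using rename_poly_single[of \<sigma> 0 1]
  by (simp add: map_key_zero bij_imp_bij_inv bij_is_inj)

lemma rename_x: "bij \<pi> \<Longrightarrow> rename (perm_y \<pi>) (x_var i) = x_var i"
  and rename_y: "bij \<pi> \<Longrightarrow> rename (perm_y \<pi>) (y_var j) = y_var (\<pi> j)"
  by (simp_all add: x_var_def y_var_def var_poly_def rename_Fract bij_perm_y rename_poly_1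
        rename_poly_single map_key_inv_single)

definition symmetric_in_y :: "nat \<Rightarrow> 'a::field ratfun \<Rightarrow> bool" where
  "symmetric_in_y m f \<longleftrightarrow> (\<forall>\<pi>. \<pi> permutes {1..m} \<longrightarrow> rename (perm_y \<pi>) f = f)"


section \<open>Non-intersecting lattice paths in matrix coordinates\<close>

type_synonym point = "nat \<times> nat"

text \<open>The first disjunct is an Up step \<open>(p, q) \<rightarrow> (p - 1, q)\<close>, the second a Right step.\<close>

definition lattice_step :: "point \<Rightarrow> point \<Rightarrow> bool" where
  "lattice_step u v \<longleftrightarrow>
     fst u = Suc (fst v) \<and> snd u = snd v \<or> fst v = fst u \<and> snd v = Suc (snd u)"

definition lattice_paths :: "nat \<Rightarrow> nat \<Rightarrow> point \<Rightarrow> point \<Rightarrow> point list set" where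
  "lattice_paths n m A B =
     {\<gamma>. \<gamma> \<noteq> [] \<and> hd \<gamma> = A \<and> last \<gamma> = B \<and> set \<gamma> \<subseteq> {1..n} \<times> {1..m} \<and>
         successively lattice_step \<gamma>}"

definition path_families ::
  "nat \<Rightarrow> nat \<Rightarrow> nat \<Rightarrow> (nat \<Rightarrow> point) \<Rightarrow> (nat \<Rightarrow> point) \<Rightarrow> (nat \<Rightarrow> point list) set" where
  "path_families n m k A B =
     {\<Upsilon> \<in> \<Pi>\<^sub>E i\<in>{1..k}. lattice_paths n m (A i) (B i).
        \<forall>i\<in>{1..k}. \<forall>j\<in>{1..k}. i \<noteq> j \<longrightarrow> set (\<Upsilon> i) \<inter> set (\<Upsilon> j) = {}}"

definition path_weight :: "point list \<Rightarrow> 'a::field ratfun" where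
  "path_weight \<gamma> = (\<Prod>(i, j)\<in>set \<gamma>. 1 / (x_var i + y_var j))"

definition F_paths :: "nat \<Rightarrow> nat \<Rightarrow> nat \<Rightarrow> (nat \<Rightarrow> point) \<Rightarrow> (nat \<Rightarrow> point) \<Rightarrow> 'a::field ratfun" where
  "F_paths n m k A B = (\<Sum>\<Upsilon>\<in>path_families n m k A B. \<Prod>i\<in>{1..k}. path_weight (\<Upsilon> i))"

text \<open>The sum defining \<^const>\<open>F_paths\<close> is a genuine finite sum.\<close>

lemma distinct_lattice_path:
  assumes "successively lattice_step \<gamma>"
  shows "distinct \<gamma>"
proof -
  define h :: "point \<Rightarrow> int" where "h u = int (snd u) - int (fst u)" for u
  have "successively (\<lambda>u v. h u < h v) \<gamma>"
    using assms by (rule successively_mono) (auto simp: lattice_step_def h_def)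
  then have "sorted_wrt (\<lambda>u v. h u < h v) \<gamma>"
    by (subst (asm) successively_iff_sorted_wrt_strong) auto
  then show ?thesis
    by (induction \<gamma>) auto
qed

lemma finite_lattice_paths: "finite (lattice_paths n m A B)"
proof (rule finite_subset)
  show "lattice_paths n m A B \<subseteq> {\<gamma>. set \<gamma> \<subseteq> {1..n} \<times> {1..m} \<and> distinct \<gamma>}"
    by (auto simp: lattice_paths_def distinct_lattice_path)
  show "finite {\<gamma> :: point list. set \<gamma> \<subseteq> {1..n} \<times> {1..m} \<and> distinct \<gamma>}"
    by (rule finite_subset_distinct) simp
qed

lemma finite_path_families: "finite (path_families n m k A B)"
  unfolding path_families_def
  by (rule finite_subset[OF _ finite_PiE[of "{1..k}" "\<lambda>i. lattice_paths n m (A i) (B i)"]])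
     (auto simp: finite_lattice_paths)

end

theory Submission
  imports Defs
begin

text \<open>
  The generating function is a product of transfer matrices, one for each column, and these
  matrices commute.

  Cut the paths of a family between the columns. In column \<open>q\<close> path \<open>i\<close> is a vertical segment,
  and the segments of different paths are disjoint. For fixed rows in which the paths enter
  and leave, the column contributes the product of the weights \<open>1 / (x r + y q)\<close> over these
  segments (\<open>column_weight\<close>). Summing over the rows in which the paths change column gives
  \<open>F\<close> as an entry of the product of the column matrices, in the order of the columns
  (\<open>sum_initial_families_eq_transfer\<close>). Applying a permutation of the \<open>y\<close> variables to \<open>F\<close>
  permutes these factors, so it is enough that two such matrices commute.

  For this, fix the rows \<open>a\<close> in which the paths enter a pair of adjacent columns and the rows
  \<open>b\<close> in which they leave it. The row in which path \<open>i\<close> changes column then ranges over an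
  interval that depends on \<open>a\<close> and \<open>b\<close> only, not on the choices of the other paths. So the sum
  is a product (\<open>two_columns_factorize\<close>): one factor for each path, the generating function of a
  single path crossing two columns within that interval, and one factor for the points which
  the paths are forced to use. The forced points occupy the same rows in both columns, so their
  factor is symmetric in the two columns. The single-path factor is symmetric as well, by a
  telescoping sum (\<open>two_column_symmetric\<close>) that rests on
  \<open>1 / (x r + s) - 1 / (x r + t) = (t - s) / ((x r + s) * (x r + t))\<close>, where \<open>t - s\<close> is
  independent of the row.
\<close>


section \<open>Commuting column weights\<close>

text \<open>
  The sum is the generating function of a single path that crosses two adjacent columns in
  the rows \<open>L..R\<close>, changing column in row \<open>c\<close>. For \<open>f r = 1 / (x r + s)\<close> and
  \<open>g r = 1 / (x r + t)\<close> the hypothesis holds with \<open>d = t - s\<close>; that \<open>d\<close> does not depend on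
  the row is the only property of the weights behind the whole theorem. It turns
  \<open>d\<close> times the summand for \<open>c\<close> into a difference of consecutive products
  \<open>g L \<cdots> g (c - 1) * f c \<cdots> f R\<close>, so the sum telescopes.
\<close>

lemma two_column_telescope:
  fixes f g :: "nat \<Rightarrow> 'a::comm_ring_1"
  assumes fg: "\<And>r. f r - g r = d * (f r * g r)"
  shows "d * (\<Sum>c\<in>{L..R}. (\<Prod>r\<in>{c..R}. f r) * (\<Prod>r\<in>{L..c}. g r))
           = (\<Prod>r\<in>{L..R}. f r) - (\<Prod>r\<in>{L..R}. g r)"
proof (cases "L \<le> R")
  case True
  then show ?thesis
  proof (induction R rule: dec_induct)
    case base
    then show ?case using fg[of L] by simp
  next
    case (step R)
    have "(\<Sum>c\<in>{L..R}. (\<Prod>r\<in>{c..Suc R}. f r) * (\<Prod>r\<in>{L..c}. g r))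
        = f (Suc R) * (\<Sum>c\<in>{L..R}. (\<Prod>r\<in>{c..R}. f r) * (\<Prod>r\<in>{L..c}. g r))"
      unfolding sum_distrib_left
      by (rule sum.cong) (simp_all add: prod.nat_ivl_Suc' mult_ac)
    then have "d * (\<Sum>c\<in>{L..Suc R}. (\<Prod>r\<in>{c..Suc R}. f r) * (\<Prod>r\<in>{L..c}. g r))
        = f (Suc R) * (d * (\<Sum>c\<in>{L..R}. (\<Prod>r\<in>{c..R}. f r) * (\<Prod>r\<in>{L..c}. g r)))
          + (d * (f (Suc R) * g (Suc R))) * (\<Prod>r\<in>{L..R}. g r)"
      using step.hyps by (simp add: algebra_simps)
    also have "\<dots> = (\<Prod>r\<in>{L..Suc R}. f r) - (\<Prod>r\<in>{L..Suc R}. g r)"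
      unfolding step.IH fg[symmetric] using step.hyps by (simp add: algebra_simps)
    finally show ?case .
  qed
qed simp

text \<open>
  Exchanging \<open>f\<close> and \<open>g\<close> negates both \<open>d\<close> and the right-hand side of the telescoped identity,
  so \<open>d\<close> can be cancelled unless it is \<open>0\<close>, and then \<open>f = g\<close>.
\<close>

lemma two_column_symmetric:
  fixes f g :: "nat \<Rightarrow> 'a::idom"
  assumes fg: "\<And>r. f r - g r = d * (f r * g r)"
  shows "(\<Sum>c\<in>{L..R}. (\<Prod>r\<in>{c..R}. f r) * (\<Prod>r\<in>{L..c}. g r))
       = (\<Sum>c\<in>{L..R}. (\<Prod>r\<in>{c..R}. g r) * (\<Prod>r\<in>{L..c}. f r))"
    (is "?fg = ?gf")
proof (cases "d = 0")
  case True
  then have "f = g" using fg by (simp add: fun_eq_iff)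
  then show ?thesis by simp
next
  case False
  have "g r - f r = - d * (g r * f r)" for r
    using fg[of r] by (simp add: algebra_simps)
  then have "- d * ?gf = (\<Prod>r\<in>{L..R}. g r) - (\<Prod>r\<in>{L..R}. f r)"
    by (rule two_column_telescope)
  moreover have "d * ?fg = (\<Prod>r\<in>{L..R}. f r) - (\<Prod>r\<in>{L..R}. g r)"
    using fg by (rule two_column_telescope)
  ultimately have "d * ?fg = d * ?gf"
    by (simp add: algebra_simps)
  then show ?thesis
    using False by simp
qed

text \<open>
  The paths of a family run upwards in a column from the rows \<open>a i\<close> to the rows \<open>c i\<close>. For
  increasing \<open>c\<close> this condition says exactly that the vertical segments \<open>{c i..a i}\<close> are
  nonempty and pairwise disjoint (\<open>interlaced_iff_disjoint\<close> below).
\<close>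

definition interlaced :: "nat \<Rightarrow> (nat \<Rightarrow> nat) \<Rightarrow> (nat \<Rightarrow> nat) \<Rightarrow> bool" where
  "interlaced k a c \<longleftrightarrow> (\<forall>i\<in>{1..k}. c i \<le> a i) \<and> (\<forall>i\<in>{1..<k}. a i < c (Suc i))"

definition column_weight :: "nat \<Rightarrow> (nat \<Rightarrow> 'a::comm_semiring_1) \<Rightarrow> (nat \<Rightarrow> nat) \<Rightarrow> (nat \<Rightarrow> nat) \<Rightarrow> 'a"
  where "column_weight k f a c =
    (if interlaced k a c then \<Prod>i\<in>{1..k}. \<Prod>r\<in>{c i..a i}. f r else 0)"

text \<open>
  For given entry rows \<open>a\<close> into the first of two columns and exit rows \<open>b\<close> from the second,
  \<open>first_row\<close> and \<open>last_row\<close> bound the row in which path \<open>i\<close> may change column: it has to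
  stay weakly between its own entry and exit, strictly below the entry of path \<open>i - 1\<close> and above
  the exit of path \<open>i + 1\<close>.
\<close>

definition first_row :: "(nat \<Rightarrow> nat) \<Rightarrow> (nat \<Rightarrow> nat) \<Rightarrow> nat \<Rightarrow> nat" where
  "first_row a b i = (if i = 1 then b 1 else max (b i) (Suc (a (i - 1))))"

definition last_row :: "nat \<Rightarrow> (nat \<Rightarrow> nat) \<Rightarrow> (nat \<Rightarrow> nat) \<Rightarrow> nat \<Rightarrow> nat" where
  "last_row k a b i = (if i = k then a k else min (a i) (b (Suc i) - 1))"

text \<open>
  Once \<open>a\<close> and \<open>b\<close> are fixed, the rows in which the \<open>k\<close> paths change column are constrained
  independently of each other, so the sum over \<open>c\<close> is a product of single-path sums. Path
  \<open>i\<close> also covers forced points: the rows below \<open>last_row\<close> in the first column and those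
  above \<open>first_row\<close> in the second. If \<open>b (i + 1) \<le> a i\<close>, the rows forced on path \<open>i\<close> in the
  first column and the rows forced on path \<open>i + 1\<close> in the second are the same set
  \<open>{b (i + 1)..a i}\<close>, and otherwise both are empty; hence the last factor, which is visibly
  symmetric in \<open>f\<close> and \<open>g\<close>.
\<close>

lemma two_columns_factorize:
  fixes f g :: "nat \<Rightarrow> 'a::comm_semiring_1"
  assumes "k \<ge> 1" and a: "\<And>i. i \<in> {1..k} \<Longrightarrow> a i \<le> n" and b: "\<And>i. i \<in> {1..k} \<Longrightarrow> 1 \<le> b i"
  shows "(\<Sum>c\<in>{1..k} \<rightarrow>\<^sub>E {1..n}. column_weight k f a c * column_weight k g c b)
       = (\<Prod>i\<in>{1..k}. \<Sum>c\<in>{first_row a b i..last_row k a b i}.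
           (\<Prod>r\<in>{c..last_row k a b i}. f r) * (\<Prod>r\<in>{first_row a b i..c}. g r))
         * (\<Prod>i\<in>{1..<k}. \<Prod>r\<in>{b (Suc i)..a i}. f r * g r)"
proof -
  define L where "L = first_row a b"
  define R where "R = last_row k a b"
  note L_def = L_def first_row_def and R_def = R_def last_row_def
  have range: "c \<in> ({1..k} \<rightarrow>\<^sub>E {1..n}) \<and> interlaced k a c \<and> interlaced k c b
      \<longleftrightarrow> c \<in> (\<Pi>\<^sub>E i\<in>{1..k}. {L i..R i})" for c
  proof
    assume c: "c \<in> ({1..k} \<rightarrow>\<^sub>E {1..n}) \<and> interlaced k a c \<and> interlaced k c b"
    have "L i \<le> c i \<and> c i \<le> R i" if i: "i \<in> {1..k}" for i
    proof
      have "a (i - 1) < c i" if "i \<noteq> 1"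
      proof -
        have "i - 1 \<in> {1..<k}" "Suc (i - 1) = i" using i that by auto
        moreover have "\<forall>i\<in>{1..<k}. a i < c (Suc i)" using c by (simp add: interlaced_def)
        ultimately show ?thesis by metis
      qed
      then show "L i \<le> c i" using c i by (auto simp: L_def interlaced_def)
      have "c i < b (Suc i)" if "i \<noteq> k"
        using c i that by (auto simp: interlaced_def)
      moreover have "c i \<le> a i" using c i by (simp add: interlaced_def)
      ultimately show "c i \<le> R i" by (auto simp: R_def)
    qed
    then show "c \<in> (\<Pi>\<^sub>E i\<in>{1..k}. {L i..R i})"
      using c by (auto simp: PiE_iff)
  next
    assume c: "c \<in> (\<Pi>\<^sub>E i\<in>{1..k}. {L i..R i})"
    then have cL: "L i \<le> c i" and cR: "c i \<le> R i" if "i \<in> {1..k}" for i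
      using that by (auto simp: PiE_iff)
    have bc: "b i \<le> c i" if "i \<in> {1..k}" for i
      using cL[OF that] by (auto simp: L_def split: if_splits)
    have ca: "c i \<le> a i" if "i \<in> {1..k}" for i
      using cR[OF that] by (auto simp: R_def split: if_splits)
    have ac: "a i < c (Suc i)" if "i \<in> {1..<k}" for i
      using cL[of "Suc i"] that by (auto simp: L_def)
    have cb: "c i < b (Suc i)" if "i \<in> {1..<k}" for i
      using cR[of i] that b[of "Suc i"] by (auto simp: R_def)
    have "c i \<in> {1..n}" if "i \<in> {1..k}" for i
      using bc[OF that] ca[OF that] a[OF that] b[OF that] by simp
    then show "c \<in> ({1..k} \<rightarrow>\<^sub>E {1..n}) \<and> interlaced k a c \<and> interlaced k c b"
      using c bc ca ac cb unfolding interlaced_def PiE_iff by blast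
  qed
  have split: "(\<Prod>r\<in>{c..a i}. f r) * (\<Prod>r\<in>{b i..c}. g r)
      = ((\<Prod>r\<in>{c..R i}. f r) * (\<Prod>r\<in>{L i..c}. g r))
        * ((\<Prod>r\<in>{Suc (R i)..a i}. f r) * (\<Prod>r\<in>{b i..<L i}. g r))"
    if i: "i \<in> {1..k}" and c: "c \<in> {L i..R i}" for i c
  proof -
    have le: "b i \<le> L i" "R i \<le> a i" using i by (auto simp: L_def R_def)
    have "{c..a i} = {c..R i} \<union> {Suc (R i)..a i}" "{b i..c} = {b i..<L i} \<union> {L i..c}"
      using c le by auto
    then have "(\<Prod>r\<in>{c..a i}. f r) = (\<Prod>r\<in>{c..R i}. f r) * (\<Prod>r\<in>{Suc (R i)..a i}. f r)"
      "(\<Prod>r\<in>{b i..c}. g r) = (\<Prod>r\<in>{b i..<L i}. g r) * (\<Prod>r\<in>{L i..c}. g r)"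
      by (simp_all add: prod.union_disjoint ivl_disj_int)
    then show ?thesis by (simp add: mult_ac)
  qed
  have f_rest: "(\<Prod>i\<in>{1..k}. \<Prod>r\<in>{Suc (R i)..a i}. f r)
      = (\<Prod>i\<in>{1..<k}. \<Prod>r\<in>{b (Suc i)..a i}. f r)"
  proof (rule prod.mono_neutral_cong_right)
    show "\<forall>i\<in>{1..k} - {1..<k}. (\<Prod>r\<in>{Suc (R i)..a i}. f r) = 1"
      by (auto simp: R_def)
    show "(\<Prod>r\<in>{Suc (R i)..a i}. f r) = (\<Prod>r\<in>{b (Suc i)..a i}. f r)" if "i \<in> {1..<k}" for i
      using that b[of "Suc i"] by (intro prod.cong) (auto simp: R_def)
  qed auto
  \<comment> \<open>Path \<open>1\<close> has no forced rows in the second column; shift the index of the others.\<close>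
  have "(\<Prod>i\<in>{1..k}. \<Prod>r\<in>{b i..<L i}. g r) = (\<Prod>i\<in>{Suc 1..<Suc k}. \<Prod>r\<in>{b i..<L i}. g r)"
    by (rule prod.mono_neutral_right) (auto simp: L_def not_le less_Suc_eq)
  also have "\<dots> = (\<Prod>i\<in>{1..<k}. \<Prod>r\<in>{b (Suc i)..<L (Suc i)}. g r)"
    by (rule prod.shift_bounds_Suc_ivl)
  also have "\<dots> = (\<Prod>i\<in>{1..<k}. \<Prod>r\<in>{b (Suc i)..a i}. g r)"
    by (intro prod.cong) (auto simp: L_def)
  finally have g_rest: "(\<Prod>i\<in>{1..k}. \<Prod>r\<in>{b i..<L i}. g r)
      = (\<Prod>i\<in>{1..<k}. \<Prod>r\<in>{b (Suc i)..a i}. g r)" .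
  have "(\<Sum>c\<in>{1..k} \<rightarrow>\<^sub>E {1..n}. column_weight k f a c * column_weight k g c b)
      = (\<Sum>c\<in>(\<Pi>\<^sub>E i\<in>{1..k}. {L i..R i}).
           \<Prod>i\<in>{1..k}. (\<Prod>r\<in>{c i..a i}. f r) * (\<Prod>r\<in>{b i..c i}. g r))"
  proof (rule sum.mono_neutral_cong_right)
    show "finite ({1..k} \<rightarrow>\<^sub>E {1..n})" by (simp add: finite_PiE)
    show "(\<Pi>\<^sub>E i\<in>{1..k}. {L i..R i}) \<subseteq> ({1..k} \<rightarrow>\<^sub>E {1..n})" using range by blast
    show "\<forall>c\<in>({1..k} \<rightarrow>\<^sub>E {1..n}) - (\<Pi>\<^sub>E i\<in>{1..k}. {L i..R i}).
        column_weight k f a c * column_weight k g c b = 0"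
      using range unfolding column_weight_def by auto
    show "column_weight k f a c * column_weight k g c b
        = (\<Prod>i\<in>{1..k}. (\<Prod>r\<in>{c i..a i}. f r) * (\<Prod>r\<in>{b i..c i}. g r))"
      if "c \<in> (\<Pi>\<^sub>E i\<in>{1..k}. {L i..R i})" for c
      using range[of c] that unfolding column_weight_def by (simp add: prod.distrib)
  qed
  also have "\<dots> = (\<Prod>i\<in>{1..k}. \<Sum>c\<in>{L i..R i}. (\<Prod>r\<in>{c..a i}. f r) * (\<Prod>r\<in>{b i..c}. g r))"
    by (rule prod_sum_PiE[symmetric]) auto
  also have "\<dots> = (\<Prod>i\<in>{1..k}. (\<Sum>c\<in>{L i..R i}. (\<Prod>r\<in>{c..R i}. f r) * (\<Prod>r\<in>{L i..c}. g r))
        * ((\<Prod>r\<in>{Suc (R i)..a i}. f r) * (\<Prod>r\<in>{b i..<L i}. g r)))"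
    unfolding sum_distrib_right by (intro prod.cong sum.cong refl split)
  also have "\<dots> = (\<Prod>i\<in>{1..k}. \<Sum>c\<in>{L i..R i}. (\<Prod>r\<in>{c..R i}. f r) * (\<Prod>r\<in>{L i..c}. g r))
         * (\<Prod>i\<in>{1..<k}. \<Prod>r\<in>{b (Suc i)..a i}. f r * g r)"
    by (simp only: prod.distrib f_rest g_rest)
  finally show ?thesis unfolding L_def(1) R_def(1) .
qed

lemma column_weights_commute:
  fixes f g :: "nat \<Rightarrow> 'a::idom"
  assumes "k \<ge> 1" "\<And>i. i \<in> {1..k} \<Longrightarrow> a i \<le> n" "\<And>i. i \<in> {1..k} \<Longrightarrow> 1 \<le> b i"
    and "\<And>r. f r - g r = d * (f r * g r)"
  shows "(\<Sum>c\<in>{1..k} \<rightarrow>\<^sub>E {1..n}. column_weight k f a c * column_weight k g c b)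
       = (\<Sum>c\<in>{1..k} \<rightarrow>\<^sub>E {1..n}. column_weight k g a c * column_weight k f c b)"
proof -
  have factors: "(\<Sum>c\<in>{p..q}. (\<Prod>r\<in>{c..q}. f r) * (\<Prod>r\<in>{p..c}. g r))
      = (\<Sum>c\<in>{p..q}. (\<Prod>r\<in>{c..q}. g r) * (\<Prod>r\<in>{p..c}. f r))" for p q
    using assms(4) by (rule two_column_symmetric)
  note factorize = two_columns_factorize[where k = k and a = a and b = b and n = n]
  show ?thesis
    by (subst (1 2) factorize) (simp_all only: assms(1-3) factors mult.commute[of "f _" "g _"])
qed


section \<open>Products of column matrices\<close>

text \<open>
  \<open>transfer n k w m a b\<close> is the generating function of families that enter column \<open>1\<close> in the
  rows \<open>a\<close> and leave column \<open>m\<close> in the rows \<open>b\<close>, written as a product of \<open>m\<close> matrices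
  indexed by \<open>k\<close>-tuples of rows. The empty product is the identity matrix.
\<close>

primrec transfer :: "nat \<Rightarrow> nat \<Rightarrow> (nat \<Rightarrow> nat \<Rightarrow> 'a::comm_semiring_1) \<Rightarrow> nat \<Rightarrow>
    (nat \<Rightarrow> nat) \<Rightarrow> (nat \<Rightarrow> nat) \<Rightarrow> 'a" where
  "transfer n k w 0 a b = (if \<forall>i\<in>{1..k}. a i = b i then 1 else 0)"
| "transfer n k w (Suc m) a b =
     (\<Sum>c\<in>{1..k} \<rightarrow>\<^sub>E {1..n}. transfer n k w m a c * column_weight k (\<lambda>r. w r (Suc m)) c b)"

lemma transfer_cong:
  assumes "\<And>r q. q \<in> {1..m} \<Longrightarrow> w r q = w' r q"
  shows "transfer n k w m a b = transfer n k w' m a b"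
  using assms
proof (induction m arbitrary: b)
  case (Suc m)
  have "transfer n k w m a c = transfer n k w' m a c" for c by (rule Suc.IH) (simp add: Suc.prems)
  moreover have "(\<lambda>r. w r (Suc m)) = (\<lambda>r. w' r (Suc m))" using Suc.prems by simp
  ultimately show ?case by simp
qed simp

text \<open>
  Only the last two factors of the product of the first \<open>j + 1\<close> matrices are exchanged, and
  these commute; further columns are unaffected.
\<close>

lemma transfer_adjacent:
  fixes x y :: "nat \<Rightarrow> 'a::field"
  assumes "k \<ge> 1" "\<And>r q. x r + y q \<noteq> 0" "\<And>i. i \<in> {1..k} \<Longrightarrow> 1 \<le> b i" "1 \<le> j" "j < m"
  shows "transfer n k (\<lambda>r q. 1 / (x r + (y \<circ> transpose j (Suc j)) q)) m a b
       = transfer n k (\<lambda>r q. 1 / (x r + y q)) m a b"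
  using assms(3,5)
proof (induction m arbitrary: b)
  case (Suc m)
  let ?w = "\<lambda>r q. 1 / (x r + y q)" and ?w' = "\<lambda>r q. 1 / (x r + (y \<circ> transpose j (Suc j)) q)"
  let ?I = "{1..k} \<rightarrow>\<^sub>E {1..n}"
  show ?case
  proof (cases "j < m")
    case True
    have "transfer n k ?w' m a c = transfer n k ?w m a c" if "c \<in> ?I" for c
      using that True by (intro Suc.IH) (auto simp: PiE_iff)
    moreover have "(\<lambda>r. ?w' r (Suc m)) = (\<lambda>r. ?w r (Suc m))"
      using True by (simp add: transpose_def)
    ultimately show ?thesis by simp
  next
    case False
    then have m: "m = j" using Suc.prems by simp
    then obtain m' where j: "j = Suc m'" using \<open>1 \<le> j\<close> by (cases j) auto
    have two: "transfer n k v (Suc (Suc m')) a b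
        = (\<Sum>c\<in>?I. transfer n k v m' a c *
            (\<Sum>d\<in>?I. column_weight k (\<lambda>r. v r (Suc m')) c d
                    * column_weight k (\<lambda>r. v r (Suc (Suc m'))) d b))"
      for v :: "nat \<Rightarrow> nat \<Rightarrow> 'a"
      by (simp add: sum_distrib_left sum_distrib_right mult_ac) (rule sum.swap)
    have "transfer n k ?w' m' a c = transfer n k ?w m' a c" for c
      by (rule transfer_cong) (simp add: j transpose_def)
    moreover have "(\<Sum>d\<in>?I. column_weight k (\<lambda>r. ?w' r (Suc m')) c d
                    * column_weight k (\<lambda>r. ?w' r (Suc (Suc m'))) d b)
        = (\<Sum>d\<in>?I. column_weight k (\<lambda>r. ?w r (Suc m')) c d
                    * column_weight k (\<lambda>r. ?w r (Suc (Suc m'))) d b)" if "c \<in> ?I" for c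
    proof -
      let ?f = "\<lambda>r. 1 / (x r + y (Suc m'))" and ?g = "\<lambda>r. 1 / (x r + y (Suc (Suc m')))"
      have "?g r - ?f r = (y (Suc m') - y (Suc (Suc m'))) * (?g r * ?f r)" for r
        using assms(2) by (simp add: field_simps)
      then have "(\<Sum>d\<in>?I. column_weight k ?g c d * column_weight k ?f d b)
          = (\<Sum>d\<in>?I. column_weight k ?f c d * column_weight k ?g d b)"
        using assms(1) Suc.prems(1) that by (intro column_weights_commute) (auto simp: PiE_iff)
      then show ?thesis by (simp add: j)
    qed
    ultimately show ?thesis
      unfolding m j two by (intro sum.cong) auto
  qed
qed simp

text \<open>
  A transposition of two columns is a conjugate of a transposition of columns at smaller
  distance by an adjacent one, so adjacent transpositions suffice. The invariance is
  quantified over all \<open>y\<close> to make it closed under composition.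
\<close>

lemma transfer_permuted:
  fixes x y :: "nat \<Rightarrow> 'a::field"
  assumes "k \<ge> 1" "\<And>r q. x r + y q \<noteq> 0" "\<And>i. i \<in> {1..k} \<Longrightarrow> 1 \<le> b i" "\<pi> permutes {1..m}"
  shows "transfer n k (\<lambda>r q. 1 / (x r + (y \<circ> \<pi>) q)) m a b
       = transfer n k (\<lambda>r q. 1 / (x r + y q)) m a b"
proof -
  define invariant where "invariant \<sigma> \<longleftrightarrow> (\<forall>y :: nat \<Rightarrow> 'a. (\<forall>r q. x r + y q \<noteq> 0) \<longrightarrow>
      transfer n k (\<lambda>r q. 1 / (x r + (y \<circ> \<sigma>) q)) m a b
      = transfer n k (\<lambda>r q. 1 / (x r + y q)) m a b)" for \<sigma> :: "nat \<Rightarrow> nat"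
  \<comment> \<open>Apply the invariance under \<open>\<tau>\<close> to the parameters \<open>y \<circ> \<sigma>\<close>.\<close>
  have comp: "invariant (\<sigma> \<circ> \<tau>)" if "invariant \<sigma>" "invariant \<tau>" for \<sigma> \<tau>
    unfolding invariant_def
  proof (intro allI impI)
    fix y :: "nat \<Rightarrow> 'a" assume y: "\<forall>r q. x r + y q \<noteq> 0"
    then have "\<forall>r q. x r + (y \<circ> \<sigma>) q \<noteq> 0" by simp
    with that(2) have "transfer n k (\<lambda>r q. 1 / (x r + ((y \<circ> \<sigma>) \<circ> \<tau>) q)) m a b
        = transfer n k (\<lambda>r q. 1 / (x r + (y \<circ> \<sigma>) q)) m a b"
      unfolding invariant_def by blast
    also have "\<dots> = transfer n k (\<lambda>r q. 1 / (x r + y q)) m a b"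
      using that(1) y unfolding invariant_def by blast
    finally show "transfer n k (\<lambda>r q. 1 / (x r + (y \<circ> (\<sigma> \<circ> \<tau>)) q)) m a b
      = transfer n k (\<lambda>r q. 1 / (x r + y q)) m a b"
      unfolding o_assoc .
  qed
  have adjacent: "invariant (transpose j (Suc j))" if "1 \<le> j" "j < m" for j
    unfolding invariant_def using assms(1,3) that by (intro allI impI transfer_adjacent) auto
  have up: "invariant (transpose i j)" if "i < j" "1 \<le> i" "j \<le> m" for i j
    using that
  proof (induction j rule: less_induct)
    case (less j)
    then obtain j' where j': "j = Suc j'" by (cases j) auto
    show ?case
    proof (cases "i = j'")
      case True
      then show ?thesis using adjacent[of j'] less.prems j' by simp
    next
      case False
      have inv1: "invariant (transpose i j')" "invariant (transpose j' j)"
        using less.IH[of j'] adjacent[of j'] less.prems j' False by simp_all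
      have "transpose i j = transpose i j' \<circ> transpose j' j \<circ> transpose i j'"
        using False less.prems j' by (intro transpose_comp_triple[symmetric]) auto
      then show ?thesis using inv1 by (simp only: comp)
    qed
  qed
  have "invariant \<pi>"
    using assms(4) finite_atLeastAtMost
  proof (induction rule: permutes_induct)
    case id
    show ?case by (simp add: invariant_def)
  next
    case (swap i j p)
    then have "invariant (transpose i j)"
      using up[of i j] up[of j i] by (cases "i < j") (auto simp: transpose_commute)
    then show ?case using comp swap.IH by blast
  qed
  then show ?thesis using assms(2) by (simp add: invariant_def)
qed


section \<open>Cutting path families into columns\<close>

definition vertical_path :: "nat \<Rightarrow> nat \<Rightarrow> nat \<Rightarrow> point list" where
  "vertical_path q b c = map (\<lambda>r. (r, q)) (rev [b..<Suc c])"

lemma set_vertical_path: "set (vertical_path q b c) = (\<lambda>r. (r, q)) ` {b..c}"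
  by (auto simp: vertical_path_def)

lemma vertical_path_eq_Nil: "vertical_path q b c = [] \<longleftrightarrow> c < b"
  by (auto simp: vertical_path_def)

lemma vertical_path_Suc: "b \<le> Suc c \<Longrightarrow> vertical_path q b (Suc c) = (Suc c, q) # vertical_path q b c"
  by (simp add: vertical_path_def)

lemma vertical_path_same: "vertical_path q b b = [(b, q)]"
  by (simp add: vertical_path_def)

lemma vertical_path_is_path:
  assumes "b \<le> c"
  shows "hd (vertical_path q b c) = (c, q) \<and> last (vertical_path q b c) = (b, q)
    \<and> successively lattice_step (vertical_path q b c)"
  using assms
proof (induction c rule: dec_induct)
  case base
  then show ?case by (simp add: vertical_path_same)
next
  case (step c)
  then have "vertical_path q b c \<noteq> []" by (simp add: vertical_path_eq_Nil)
  then show ?case using step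
    by (cases "vertical_path q b c") (auto simp: vertical_path_Suc lattice_step_def)
qed

lemma path_in_column:
  assumes "\<gamma> \<noteq> []" "successively lattice_step \<gamma>" "\<forall>p\<in>set \<gamma>. snd p = q"
  shows "fst (last \<gamma>) \<le> fst (hd \<gamma>) \<and> \<gamma> = vertical_path q (fst (last \<gamma>)) (fst (hd \<gamma>))"
  using assms
proof (induction \<gamma> rule: list_nonempty_induct)
  case (single p)
  then show ?case by (cases p) (simp add: vertical_path_same)
next
  case (cons p \<gamma>)
  then have step: "lattice_step p (hd \<gamma>)" and "successively lattice_step \<gamma>"
    by (simp_all add: successively_Cons)
  then have IH: "fst (last \<gamma>) \<le> fst (hd \<gamma>)" "\<gamma> = vertical_path q (fst (last \<gamma>)) (fst (hd \<gamma>))"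
    using cons by auto
  have "snd (hd \<gamma>) = q" "snd p = q" using cons by auto
  then have p: "p = (Suc (fst (hd \<gamma>)), q)"
    using step by (cases p) (auto simp: lattice_step_def)
  show ?case
    using IH cons.hyps by (simp add: p vertical_path_Suc)
qed

text \<open>
  The paths across the first \<open>m\<close> columns, with the convention that for \<open>m = 0\<close> there is just
  the empty path, which stays in its row. This lets the induction on the number of columns
  start at zero columns, so that the first column is treated like all others.
\<close>

definition initial_paths :: "nat \<Rightarrow> nat \<Rightarrow> nat \<Rightarrow> nat \<Rightarrow> point list set" where
  "initial_paths n m a c =
     (if m = 0 then (if a = c then {[]} else {}) else lattice_paths n m (a, 1) (c, m))"

lemma set_initial_path: "\<gamma> \<in> initial_paths n m a c \<Longrightarrow> set \<gamma> \<subseteq> {1..n} \<times> {1..m}"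
  by (auto simp: initial_paths_def lattice_paths_def split: if_splits)

lemma finite_initial_paths: "finite (initial_paths n m a c)"
  by (simp add: initial_paths_def finite_lattice_paths)

lemma append_column:
  assumes \<gamma>: "\<gamma> \<in> initial_paths n m a c" and "1 \<le> b" "b \<le> c" "c \<le> n"
  shows "\<gamma> @ vertical_path (Suc m) b c \<in> initial_paths n (Suc m) a b"
    and "takeWhile (\<lambda>p. snd p \<le> m) (\<gamma> @ vertical_path (Suc m) b c) = \<gamma>"
    and "fst (hd (dropWhile (\<lambda>p. snd p \<le> m) (\<gamma> @ vertical_path (Suc m) b c))) = c"
proof -
  let ?C = "vertical_path (Suc m) b c"
  have C: "?C \<noteq> []" "hd ?C = (c, Suc m)" "last ?C = (b, Suc m)" "successively lattice_step ?C"
    using vertical_path_is_path[OF \<open>b \<le> c\<close>, of "Suc m"] \<open>b \<le> c\<close> by (simp_all add: vertical_path_eq_Nil)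
  have left: "\<forall>p\<in>set \<gamma>. snd p \<le> m" using set_initial_path[OF \<gamma>] by auto
  have right: "\<forall>p\<in>set ?C. \<not> snd p \<le> m" by (auto simp: set_vertical_path)
  then have "\<not> snd (hd ?C) \<le> m" using C(1) by simp
  then have C': "takeWhile (\<lambda>p. snd p \<le> m) ?C = []" "dropWhile (\<lambda>p. snd p \<le> m) ?C = ?C"
    using C(1) by (cases ?C; simp)+
  then show "takeWhile (\<lambda>p. snd p \<le> m) (\<gamma> @ ?C) = \<gamma>"
    using left by (simp add: takeWhile_append2)
  show "fst (hd (dropWhile (\<lambda>p. snd p \<le> m) (\<gamma> @ ?C))) = c"
    using left C' C(2) by (simp add: dropWhile_append2)
  have range: "set (\<gamma> @ ?C) \<subseteq> {1..n} \<times> {1..Suc m}"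
    using set_initial_path[OF \<gamma>] assms(2-4) by (auto simp: set_vertical_path)
  have "successively lattice_step (\<gamma> @ ?C) \<and> hd (\<gamma> @ ?C) = (a, 1)"
    using \<gamma> C by (auto simp: initial_paths_def lattice_paths_def successively_append_iff
        lattice_step_def split: if_splits)
  then show "\<gamma> @ ?C \<in> initial_paths n (Suc m) a b"
    using range C(1,3) by (simp add: initial_paths_def lattice_paths_def)
qed

text \<open>
  Along a path the column index never decreases, so the points in column \<open>m + 1\<close> form a final
  segment, entered by a Right step (or, for \<open>m = 0\<close>, at the starting point) in the row \<open>c\<close>.
\<close>

lemma split_off_column:
  assumes \<gamma>: "\<gamma> \<in> initial_paths n (Suc m) a b"
  defines "\<gamma>' \<equiv> takeWhile (\<lambda>p. snd p \<le> m) \<gamma>"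
    and "c \<equiv> fst (hd (dropWhile (\<lambda>p. snd p \<le> m) \<gamma>))"
  shows "\<gamma>' \<in> initial_paths n m a c" and "b \<le> c" and "c \<in> {1..n}"
    and "\<gamma> = \<gamma>' @ vertical_path (Suc m) b c"
proof -
  define C where "C = dropWhile (\<lambda>p. snd p \<le> m) \<gamma>"
  have path: "\<gamma> \<noteq> []" "hd \<gamma> = (a, 1)" "last \<gamma> = (b, Suc m)" "set \<gamma> \<subseteq> {1..n} \<times> {1..Suc m}"
    "successively lattice_step \<gamma>"
    using \<gamma> by (simp_all add: initial_paths_def lattice_paths_def)
  have split: "\<gamma> = \<gamma>' @ C" by (simp add: \<gamma>'_def C_def)
  have C: "C \<noteq> []"
  proof
    assume "C = []"
    then have "\<forall>p\<in>set \<gamma>. snd p \<le> m" by (simp add: C_def dropWhile_eq_Nil_conv)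
    then have "snd (last \<gamma>) \<le> m" using last_in_set[OF path(1)] by blast
    then show False using path(3) by simp
  qed
  then have C_hd: "\<not> snd (hd C) \<le> m" unfolding C_def by (rule hd_dropWhile)
  have C_range: "set C \<subseteq> {1..n} \<times> {1..Suc m}"
    using path(4) set_dropWhileD unfolding C_def by fast
  have "successively (\<lambda>u v. snd u \<le> snd v) C"
    using path(5) unfolding split successively_append_iff
    by (auto elim: successively_mono simp: lattice_step_def)
  then have "sorted_wrt (\<lambda>u v. snd u \<le> snd v) C"
    by (subst (asm) successively_iff_sorted_wrt_strong) auto
  then have C_mono: "\<forall>p\<in>set C. snd (hd C) \<le> snd p" by (cases C) auto
  have "snd p = Suc m" if "p \<in> set C" for p
  proof -
    have "p \<in> {1..n} \<times> {1..Suc m}" using C_range that by blast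
    then have "snd p \<le> Suc m" by (simp add: mem_Times_iff)
    moreover have "snd (hd C) \<le> snd p" using C_mono that by blast
    ultimately show ?thesis using C_hd by simp
  qed
  then have "\<forall>p\<in>set C. snd p = Suc m" by blast
  moreover have "successively lattice_step C"
    using path(5) unfolding split successively_append_iff by simp
  moreover have last_C: "last C = (b, Suc m)" using path(3) split C by simp
  ultimately have "fst (last C) \<le> fst (hd C) \<and> C = vertical_path (Suc m) (fst (last C)) (fst (hd C))"
    by (intro path_in_column C)
  moreover have "fst (last C) = b" "fst (hd C) = c"
    by (simp add: last_C) (simp add: c_def C_def)
  ultimately have column: "b \<le> c" "C = vertical_path (Suc m) b c" by simp_all
  have hd_C: "hd C = (c, Suc m)"
    using vertical_path_is_path[OF column(1), of "Suc m"] column(2) by simp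
  show "b \<le> c" by fact
  show "\<gamma> = \<gamma>' @ vertical_path (Suc m) b c" using split column(2) by simp
  show "c \<in> {1..n}"
    using C_range hd_in_set[OF C] unfolding hd_C by auto
  show "\<gamma>' \<in> initial_paths n m a c"
  proof (cases "m = 0")
    case True
    then have "\<gamma>' = []"
      using path(4) takeWhile_eq_Nil_iff[of "\<lambda>p. snd p \<le> m" \<gamma>] path(1,2) by (simp add: \<gamma>'_def)
    then show ?thesis using True path(2) split hd_C by (simp add: initial_paths_def)
  next
    case False
    then have ne: "\<gamma>' \<noteq> []"
      using path(1,2) takeWhile_eq_Nil_iff[of "\<lambda>p. snd p \<le> m" \<gamma>] by (simp add: \<gamma>'_def)
    have left: "\<forall>p\<in>set \<gamma>'. snd p \<le> m" by (auto simp: \<gamma>'_def dest: set_takeWhileD)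
    have "lattice_step (last \<gamma>') (hd C)"
      using path(5) ne C unfolding split successively_append_iff by simp
    then have "last \<gamma>' = (c, m)"
      using left[rule_format, OF last_in_set[OF ne]] unfolding hd_C
      by (cases "last \<gamma>'") (auto simp: lattice_step_def)
    moreover have "set \<gamma>' \<subseteq> {1..n} \<times> {1..m}" 
    proof
      fix p assume "p \<in> set \<gamma>'"
      moreover from this have "p \<in> {1..n} \<times> {1..Suc m}"
        using path(4) unfolding split by (metis UnCI set_append subsetD)
      ultimately show "p \<in> {1..n} \<times> {1..m}"
        using left by (simp add: mem_Times_iff)
    qed
    moreover have "successively lattice_step \<gamma>'"
      using path(5) unfolding split successively_append_iff by simp
    ultimately show ?thesis
      using False ne path(2) split by (simp add: initial_paths_def lattice_paths_def)
  qed
qed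

definition initial_families ::
  "nat \<Rightarrow> nat \<Rightarrow> nat \<Rightarrow> (nat \<Rightarrow> nat) \<Rightarrow> (nat \<Rightarrow> nat) \<Rightarrow> (nat \<Rightarrow> point list) set" where
  "initial_families n m k a b =
     {\<Upsilon> \<in> \<Pi>\<^sub>E i\<in>{1..k}. initial_paths n m (a i) (b i).
        \<forall>i\<in>{1..k}. \<forall>j\<in>{1..k}. i \<noteq> j \<longrightarrow> set (\<Upsilon> i) \<inter> set (\<Upsilon> j) = {}}"

lemma finite_initial_families: "finite (initial_families n m k a b)"
  unfolding initial_families_def
  by (rule finite_subset[OF _ finite_PiE[of "{1..k}" "\<lambda>i. initial_paths n m (a i) (b i)"]])
     (auto simp: finite_initial_paths)

definition family_weight :: "(nat \<Rightarrow> nat \<Rightarrow> 'a::comm_semiring_1) \<Rightarrow> nat \<Rightarrow> (nat \<Rightarrow> point list) \<Rightarrow> 'a"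
  where "family_weight w k \<Upsilon> = (\<Prod>i\<in>{1..k}. \<Prod>(r, q)\<in>set (\<Upsilon> i). w r q)"

text \<open>
  Since \<open>b\<close> increases, the start \<open>b j\<close> of a later segment can only be kept out of \<open>{b i..c i}\<close>
  by \<open>c i < b j\<close>. So non-intersection within a column forces the paths to enter it in the
  order in which they leave it; this is the planarity of the configuration, one column at a time.
\<close>

lemma interlaced_iff_disjoint:
  assumes "strict_mono_on {1..k} b"
  shows "interlaced k c b \<longleftrightarrow> (\<forall>i\<in>{1..k}. b i \<le> c i)
    \<and> (\<forall>i\<in>{1..k}. \<forall>j\<in>{1..k}. i \<noteq> j \<longrightarrow> {b i..c i} \<inter> {b j..c j} = {})"
proof
  assume int: "interlaced k c b"
  have "c i < b j" if "i \<in> {1..k}" "j \<in> {1..k}" "i < j" for i j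
  proof -
    have "c i < b (Suc i)" using int that by (auto simp: interlaced_def)
    also have "b (Suc i) \<le> b j"
      using that by (intro strict_mono_on_leD[OF assms]) auto
    finally show ?thesis .
  qed
  then have "{b i..c i} \<inter> {b j..c j} = {}" if "i \<in> {1..k}" "j \<in> {1..k}" "i \<noteq> j" for i j
    using that by (cases i j rule: linorder_cases) force+
  then show "(\<forall>i\<in>{1..k}. b i \<le> c i)
    \<and> (\<forall>i\<in>{1..k}. \<forall>j\<in>{1..k}. i \<noteq> j \<longrightarrow> {b i..c i} \<inter> {b j..c j} = {})"
    using int by (simp add: interlaced_def)
next
  assume *: "(\<forall>i\<in>{1..k}. b i \<le> c i)
    \<and> (\<forall>i\<in>{1..k}. \<forall>j\<in>{1..k}. i \<noteq> j \<longrightarrow> {b i..c i} \<inter> {b j..c j} = {})"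
  have "c i < b (Suc i)" if "i \<in> {1..<k}" for i
  proof (rule ccontr)
    assume "\<not> c i < b (Suc i)"
    moreover have "b i < b (Suc i)"
      using that by (intro strict_mono_onD[OF assms]) auto
    moreover have "b (Suc i) \<le> c (Suc i)" using * that by simp
    ultimately have "b (Suc i) \<in> {b i..c i} \<inter> {b (Suc i)..c (Suc i)}" by simp
    moreover have "i \<in> {1..k}" "Suc i \<in> {1..k}" "i \<noteq> Suc i" using that by auto
    then have "{b i..c i} \<inter> {b (Suc i)..c (Suc i)} = {}" using * by blast
    ultimately show False by simp
  qed
  then show "interlaced k c b" using * by (simp add: interlaced_def)
qed

text \<open>
  This carries the hypothesis on the exit rows over from one column to the previous one.
\<close>

lemma strict_mono_on_interlaced:
  assumes "strict_mono_on {1..k} b" "interlaced k c b"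
  shows "strict_mono_on {1..k} c"
proof (rule strict_mono_onI)
  fix i j assume ij: "i \<in> {1..k}" "j \<in> {1..k}" "i < j"
  then have "c i < b (Suc i)" using assms(2) by (auto simp: interlaced_def)
  also have "b (Suc i) \<le> b j" using ij by (intro strict_mono_on_leD[OF assms(1)]) auto
  also have "b j \<le> c j" using assms(2) ij by (auto simp: interlaced_def)
  finally show "c i < c j" .
qed

text \<open>
  Cutting every path in front of its last column is a bijection from families to pairs of
  entry rows \<open>c\<close> into that column and a family that ends in those rows. Two of the paths
  are disjoint if and only if their initial parts and their segments in the last column are.
\<close>

lemma sum_initial_families_Suc:
  assumes b: "strict_mono_on {1..k} b" "\<And>i. i \<in> {1..k} \<Longrightarrow> 1 \<le> b i"
  shows "(\<Sum>\<Upsilon>\<in>initial_families n (Suc m) k a b. family_weight w k \<Upsilon>)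
       = (\<Sum>c\<in>{1..k} \<rightarrow>\<^sub>E {1..n}. (\<Sum>\<Upsilon>\<in>initial_families n m k a c. family_weight w k \<Upsilon>)
            * column_weight k (\<lambda>r. w r (Suc m)) c b)"
proof -
  let ?K = "{1..k}" and ?P = "\<lambda>p :: point. snd p \<le> m"
  define S where "S = {c \<in> ?K \<rightarrow>\<^sub>E {1..n}. interlaced k c b}"
  define glue where "glue = (\<lambda>(c, \<Upsilon>). \<lambda>i\<in>?K. \<Upsilon> i @ vertical_path (Suc m) (b i) (c i))"
  define cut where "cut \<Upsilon> = (\<lambda>i\<in>?K. fst (hd (dropWhile ?P (\<Upsilon> i))), \<lambda>i\<in>?K. takeWhile ?P (\<Upsilon> i))"
    for \<Upsilon> :: "nat \<Rightarrow> point list"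
  have separate: "set (\<gamma> @ vertical_path (Suc m) p c) \<inter> set (\<gamma>' @ vertical_path (Suc m) p' c') = {}
      \<longleftrightarrow> set \<gamma> \<inter> set \<gamma>' = {} \<and> {p..c} \<inter> {p'..c'} = {}"
    if "\<gamma> \<in> initial_paths n m s c" "\<gamma>' \<in> initial_paths n m s' c'" for \<gamma> \<gamma>' s c s' c' p p'
  proof -
    have "set \<gamma> \<inter> (\<lambda>r. (r, Suc m)) ` {p'..c'} = {}" "set \<gamma>' \<inter> (\<lambda>r. (r, Suc m)) ` {p..c} = {}"
      using set_initial_path[OF that(1)] set_initial_path[OF that(2)] by auto
    then show ?thesis unfolding set_append set_vertical_path by blast
  qed
  have glue: "glue (c, \<Upsilon>) \<in> initial_families n (Suc m) k a b" "cut (glue (c, \<Upsilon>)) = (c, \<Upsilon>)"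
    "family_weight w k (glue (c, \<Upsilon>))
       = family_weight w k \<Upsilon> * column_weight k (\<lambda>r. w r (Suc m)) c b"
    if c: "c \<in> S" and \<Upsilon>: "\<Upsilon> \<in> initial_families n m k a c" for c \<Upsilon>
  proof -
    have path: "\<Upsilon> i \<in> initial_paths n m (a i) (c i)" if "i \<in> ?K" for i
      using \<Upsilon> that by (auto simp: initial_families_def PiE_iff)
    have bc: "b i \<le> c i" "c i \<le> n" if "i \<in> ?K" for i
      using c that by (auto simp: S_def interlaced_def PiE_iff)
    have "interlaced k c b" using c by (simp add: S_def)
    then have columns: "\<forall>i\<in>?K. \<forall>j\<in>?K. i \<noteq> j \<longrightarrow> {b i..c i} \<inter> {b j..c j} = {}"
      unfolding interlaced_iff_disjoint[OF b(1)] ..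
    have disj: "set (\<Upsilon> i) \<inter> set (\<Upsilon> j) = {}" "{b i..c i} \<inter> {b j..c j} = {}"
      if "i \<in> ?K" "j \<in> ?K" "i \<noteq> j" for i j
      using columns[rule_format, OF that] \<Upsilon> that unfolding initial_families_def by simp_all
    have "set (glue (c, \<Upsilon>) i) \<inter> set (glue (c, \<Upsilon>) j) = {}"
      if "i \<in> ?K" "j \<in> ?K" "i \<noteq> j" for i j
      using separate[OF path[OF that(1)] path[OF that(2)]] disj[OF that] that
      unfolding glue_def by simp
    moreover have "glue (c, \<Upsilon>) \<in> (\<Pi>\<^sub>E i\<in>?K. initial_paths n (Suc m) (a i) (b i))"
      using append_column(1)[OF path b(2) bc] by (simp add: glue_def PiE_iff)
    ultimately show "glue (c, \<Upsilon>) \<in> initial_families n (Suc m) k a b"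
      by (simp add: initial_families_def)
    have "(\<lambda>i\<in>?K. fst (hd (dropWhile ?P (glue (c, \<Upsilon>) i)))) = (\<lambda>i\<in>?K. c i)"
      using append_column(3)[OF path b(2) bc] by (intro restrict_ext) (simp add: glue_def)
    moreover have "(\<lambda>i\<in>?K. takeWhile ?P (glue (c, \<Upsilon>) i)) = (\<lambda>i\<in>?K. \<Upsilon> i)"
      using append_column(2)[OF path b(2) bc] by (intro restrict_ext) (simp add: glue_def)
    moreover have "c \<in> extensional ?K" "\<Upsilon> \<in> extensional ?K"
      using c \<Upsilon> by (auto simp: S_def initial_families_def PiE_iff)
    ultimately show "cut (glue (c, \<Upsilon>)) = (c, \<Upsilon>)"
      by (simp add: cut_def extensional_restrict)
    have "(\<Prod>(r, q)\<in>set (\<Upsilon> i @ vertical_path (Suc m) (b i) (c i)). w r q)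
        = (\<Prod>(r, q)\<in>set (\<Upsilon> i). w r q) * (\<Prod>r\<in>{b i..c i}. w r (Suc m))" if "i \<in> ?K" for i
    proof -
      have "set (\<Upsilon> i) \<inter> (\<lambda>r. (r, Suc m)) ` {b i..c i} = {}"
        using set_initial_path[OF path[OF that]] by auto
      then have "(\<Prod>(r, q)\<in>set (\<Upsilon> i @ vertical_path (Suc m) (b i) (c i)). w r q)
          = (\<Prod>(r, q)\<in>set (\<Upsilon> i). w r q) * (\<Prod>(r, q)\<in>(\<lambda>r. (r, Suc m)) ` {b i..c i}. w r q)"
        unfolding set_append set_vertical_path by (intro prod.union_disjoint) auto
      then show ?thesis by (simp add: prod.reindex inj_on_def)
    qed
    then have "family_weight w k (glue (c, \<Upsilon>))
        = (\<Prod>i\<in>?K. (\<Prod>(r, q)\<in>set (\<Upsilon> i). w r q) * (\<Prod>r\<in>{b i..c i}. w r (Suc m)))"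
      unfolding family_weight_def by (intro prod.cong) (simp_all add: glue_def)
    then show "family_weight w k (glue (c, \<Upsilon>))
       = family_weight w k \<Upsilon> * column_weight k (\<lambda>r. w r (Suc m)) c b"
      using c by (simp add: prod.distrib family_weight_def column_weight_def S_def)
  qed
  have cut: "cut \<Upsilon> \<in> Sigma S (initial_families n m k a)" "glue (cut \<Upsilon>) = \<Upsilon>"
    if \<Upsilon>: "\<Upsilon> \<in> initial_families n (Suc m) k a b" for \<Upsilon>
  proof -
    have path: "\<Upsilon> i \<in> initial_paths n (Suc m) (a i) (b i)" if "i \<in> ?K" for i
      using \<Upsilon> that by (auto simp: initial_families_def PiE_iff)
    define c where "c = (\<lambda>i\<in>?K. fst (hd (dropWhile ?P (\<Upsilon> i))))"
    define \<Upsilon>' where "\<Upsilon>' = (\<lambda>i\<in>?K. takeWhile ?P (\<Upsilon> i))"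
    have split: "\<Upsilon>' i \<in> initial_paths n m (a i) (c i)" "b i \<le> c i" "c i \<in> {1..n}"
      "\<Upsilon> i = \<Upsilon>' i @ vertical_path (Suc m) (b i) (c i)" if "i \<in> ?K" for i
      using split_off_column[OF path[OF that]] that by (simp_all add: c_def \<Upsilon>'_def)
    have disj: "set (\<Upsilon>' i) \<inter> set (\<Upsilon>' j) = {} \<and> {b i..c i} \<inter> {b j..c j} = {}"
      if "i \<in> ?K" "j \<in> ?K" "i \<noteq> j" for i j
    proof -
      have "set (\<Upsilon> i) \<inter> set (\<Upsilon> j) = {}" using \<Upsilon> that by (simp add: initial_families_def)
      then show ?thesis
        using separate[OF split(1)[OF that(1)] split(1)[OF that(2)], of "b i" "b j"]
          split(4)[OF that(1)] split(4)[OF that(2)] by simp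
    qed
    have "interlaced k c b"
      using interlaced_iff_disjoint[OF b(1), of c] split(2) disj by blast
    then have "c \<in> S"
      using split(3) by (simp add: S_def PiE_iff) (simp add: c_def)
    moreover have "\<Upsilon>' \<in> initial_families n m k a c"
      using split(1) disj by (simp add: initial_families_def PiE_iff) (simp add: \<Upsilon>'_def)
    ultimately show "cut \<Upsilon> \<in> Sigma S (initial_families n m k a)"
      by (simp add: cut_def c_def \<Upsilon>'_def)
    have "\<Upsilon> \<in> extensional ?K" using \<Upsilon> by (simp add: initial_families_def PiE_iff)
    then have "(\<lambda>i\<in>?K. \<Upsilon>' i @ vertical_path (Suc m) (b i) (c i)) = \<Upsilon>"
      by (intro extensionalityI[of _ ?K]) (simp_all add: split(4)[symmetric])
    then show "glue (cut \<Upsilon>) = \<Upsilon>"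
      by (simp only: glue_def cut_def prod.case c_def[symmetric] \<Upsilon>'_def[symmetric])
  qed
  have "(\<Sum>\<Upsilon>\<in>initial_families n (Suc m) k a b. family_weight w k \<Upsilon>)
      = (\<Sum>(c, \<Upsilon>)\<in>Sigma S (initial_families n m k a).
           family_weight w k \<Upsilon> * column_weight k (\<lambda>r. w r (Suc m)) c b)"
  proof (rule sum.reindex_bij_witness[of _ glue cut])
    fix \<Upsilon> assume \<Upsilon>: "\<Upsilon> \<in> initial_families n (Suc m) k a b"
    show reglue: "glue (cut \<Upsilon>) = \<Upsilon>" and mem: "cut \<Upsilon> \<in> Sigma S (initial_families n m k a)"
      using cut[OF \<Upsilon>] by simp_all
    from mem obtain c \<Upsilon>' where p: "cut \<Upsilon> = (c, \<Upsilon>')" "c \<in> S" "\<Upsilon>' \<in> initial_families n m k a c"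
      by (rule SigmaE)
    show "(case cut \<Upsilon> of (c, \<Upsilon>) \<Rightarrow>
          family_weight w k \<Upsilon> * column_weight k (\<lambda>r. w r (Suc m)) c b) = family_weight w k \<Upsilon>"
      using glue(3)[OF p(2,3)] reglue by (simp add: p(1))
  next
    fix p assume "p \<in> Sigma S (initial_families n m k a)"
    then obtain c \<Upsilon> where p: "p = (c, \<Upsilon>)" "c \<in> S" "\<Upsilon> \<in> initial_families n m k a c"
      by (rule SigmaE)
    show "cut (glue p) = p" "glue p \<in> initial_families n (Suc m) k a b"
      using glue(1,2)[OF p(2,3)] p(1) by simp_all
  qed
  also have "\<dots> = (\<Sum>c\<in>S. (\<Sum>\<Upsilon>\<in>initial_families n m k a c. family_weight w k \<Upsilon>)
            * column_weight k (\<lambda>r. w r (Suc m)) c b)"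
    unfolding sum_distrib_right
    by (rule sum.Sigma[symmetric]) (auto simp: S_def finite_PiE finite_initial_families)
  also have "\<dots> = (\<Sum>c\<in>?K \<rightarrow>\<^sub>E {1..n}. (\<Sum>\<Upsilon>\<in>initial_families n m k a c. family_weight w k \<Upsilon>)
            * column_weight k (\<lambda>r. w r (Suc m)) c b)"
    by (rule sum.mono_neutral_left) (auto simp: S_def finite_PiE column_weight_def)
  finally show ?thesis .
qed

lemma sum_initial_families_eq_transfer:
  assumes "strict_mono_on {1..k} b" "\<And>i. i \<in> {1..k} \<Longrightarrow> 1 \<le> b i"
  shows "(\<Sum>\<Upsilon>\<in>initial_families n m k a b. family_weight w k \<Upsilon>) = transfer n k w m a b"
  using assms
proof (induction m arbitrary: b)
  case 0
  show ?case
  proof (cases "\<forall>i\<in>{1..k}. a i = b i")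
    case True
    then have "initial_families n 0 k a b = {\<lambda>i\<in>{1..k}. []}"
      by (auto simp: initial_families_def initial_paths_def PiE_iff extensional_def fun_eq_iff)
    then show ?thesis using True by (simp add: family_weight_def)
  next
    case False
    then have "initial_families n 0 k a b = {}"
      by (auto simp: initial_families_def initial_paths_def PiE_iff)
    then show ?thesis using False by auto
  qed
next
  case (Suc m)
  have "(\<Sum>\<Upsilon>\<in>initial_families n m k a c. family_weight w k \<Upsilon>)
          * column_weight k (\<lambda>r. w r (Suc m)) c b
      = transfer n k w m a c * column_weight k (\<lambda>r. w r (Suc m)) c b"
    if "c \<in> {1..k} \<rightarrow>\<^sub>E {1..n}" for c
  proof (cases "interlaced k c b")
    case True
    then have "strict_mono_on {1..k} c"
      using strict_mono_on_interlaced Suc.prems(1) by blast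
    moreover have "1 \<le> c i" if "i \<in> {1..k}" for i
      using \<open>c \<in> _\<close> that by (auto simp: PiE_iff)
    ultimately have "(\<Sum>\<Upsilon>\<in>initial_families n m k a c. family_weight w k \<Upsilon>)
        = transfer n k w m a c" by (rule Suc.IH)
    then show ?thesis by (rule arg_cong)
  next
    case False
    then show ?thesis by (simp add: column_weight_def)
  qed
  then show ?case
    unfolding transfer.simps
    by (subst sum_initial_families_Suc) (use Suc.prems in \<open>auto intro!: sum.cong\<close>)
qed


section \<open>Renaming variables and the symmetry of the generating function\<close>

lemma rename_0: "bij \<sigma> \<Longrightarrow> rename \<sigma> 0 = 0"
  and rename_1: "bij \<sigma> \<Longrightarrow> rename \<sigma> 1 = 1"
  by (simp_all add: Zero_fract_def One_fract_def rename_Fract rename_poly_0 rename_poly_1)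

lemma rename_add:
  assumes "bij \<sigma>"
  shows "rename \<sigma> (p + q) = rename \<sigma> p + rename \<sigma> q"
  using assms by (cases p; cases q)
    (simp add: rename_Fract rename_poly_add rename_poly_mult rename_poly_eq_0_iff)

lemma rename_mult:
  assumes "bij \<sigma>"
  shows "rename \<sigma> (p * q) = rename \<sigma> p * rename \<sigma> q"
  using assms by (cases p; cases q) (simp add: rename_Fract rename_poly_mult)

lemma rename_divide:
  assumes "bij \<sigma>"
  shows "rename \<sigma> (p / q) = rename \<sigma> p / rename \<sigma> q"
  using assms by (cases p; cases q) (simp add: rename_Fract rename_poly_mult)

lemma rename_sum: "bij \<sigma> \<Longrightarrow> rename \<sigma> (\<Sum>i\<in>I. f i) = (\<Sum>i\<in>I. rename \<sigma> (f i))"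
  by (induction I rule: infinite_finite_induct) (simp_all add: rename_0 rename_add)

lemma rename_prod: "bij \<sigma> \<Longrightarrow> rename \<sigma> (\<Prod>i\<in>I. f i) = (\<Prod>i\<in>I. rename \<sigma> (f i))"
  by (induction I rule: infinite_finite_induct) (simp_all add: rename_1 rename_mult)

lemma x_var_add_y_var_nonzero: "x_var i + y_var j \<noteq> (0 :: 'a::field ratfun)"
proof
  let ?e = "Poly_Mapping.single (XV i) (1::nat)"
  assume "x_var i + y_var j = (0 :: 'a ratfun)"
  then have "var_poly (XV i) + var_poly (YV j) = (0 :: 'a mpoly_xy)"
    by (simp add: x_var_def y_var_def Zero_fract_def eq_fract)
  then have "Poly_Mapping.lookup (var_poly (XV i) + var_poly (YV j) :: 'a mpoly_xy) ?e = 0"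
    by simp
  moreover have "Poly_Mapping.single (YV j) 1 \<noteq> ?e"
    by (metis lookup_single_eq lookup_single_not_eq var.distinct(1) zero_neq_one)
  ultimately show False
    by (simp add: var_poly_def lookup_add lookup_single)
qed

theorem theorem2p5:
  fixes k l m :: nat and a b :: "nat \<Rightarrow> nat"
  assumes "k \<ge> 1" and "m \<ge> 1"
    and "strict_mono_on {1..k} a" and "\<forall>i\<in>{1..k}. 1 \<le> a i \<and> a i \<le> k + l"
    and "strict_mono_on {1..k} b" and "\<forall>i\<in>{1..k}. 1 \<le> b i \<and> b i \<le> k + l"
  shows "symmetric_in_y m
           (F_paths (k + l) m k (\<lambda>i. (a i, 1)) (\<lambda>i. (b i, m)) :: 'a::field_char_0 ratfun)"
  unfolding symmetric_in_y_def
proof (intro allI impI)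
  fix \<pi> assume \<pi>: "\<pi> permutes {1..m}"
  let ?n = "k + l"
  let ?\<Phi> = "path_families ?n m k (\<lambda>i. (a i, 1)) (\<lambda>i. (b i, m))"
  let ?F = "F_paths ?n m k (\<lambda>i. (a i, 1)) (\<lambda>i. (b i, m)) :: 'a ratfun"
  let ?w = "\<lambda>y r q. 1 / (x_var r + y q) :: 'a ratfun"
  have bij: "bij (perm_y \<pi>)"
    by (intro bij_perm_y permutes_bij[OF \<pi>])
  have families: "?\<Phi> = initial_families ?n m k a b"
    using \<open>m \<ge> 1\<close> by (simp add: path_families_def initial_families_def initial_paths_def)
  have transfer: "(\<Sum>\<Upsilon>\<in>?\<Phi>. family_weight (?w y) k \<Upsilon>) = transfer ?n k (?w y) m a b" for y
    unfolding families using assms(5,6) by (intro sum_initial_families_eq_transfer) auto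
  have "rename (perm_y \<pi>) ?F = (\<Sum>\<Upsilon>\<in>?\<Phi>. family_weight (?w (y_var \<circ> \<pi>)) k \<Upsilon>)"
    unfolding F_paths_def path_weight_def family_weight_def
    by (simp add: rename_sum rename_prod rename_divide rename_add rename_1 bij
        rename_x[OF permutes_bij[OF \<pi>]] rename_y[OF permutes_bij[OF \<pi>]] case_prod_unfold)
  also have "\<dots> = transfer ?n k (?w (y_var \<circ> \<pi>)) m a b"
    by (rule transfer)
  also have "\<dots> = transfer ?n k (?w y_var) m a b"
    using assms(1,6) \<pi> by (intro transfer_permuted) (auto simp: x_var_add_y_var_nonzero)
  also have "\<dots> = ?F"
    unfolding transfer[symmetric] F_paths_def path_weight_def family_weight_def ..
  finally show "rename (perm_y \<pi>) ?F = ?F" .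
qed

end
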